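(* (Jumping Lemma) Let $L\in\mathcal{L}(\mathsf{DTMFA^{rej}})$ be a language over $\Sigma$. Then either $L$ is regular, or for every $m\ge0$ there exist $n\ge m$ and $p_n,v_n\in\Sigma^+$ such that: (1) $|v_n|=n$; (2) $v_n$ is a factor of $p_n$; (3) $p_nv_n$ is a prefix of a word from $L$; (4) for all $u\in\Sigma^+$, $p_nu\in L$ only if $v_n$ is a prefix of $u$.
   Context: Memory automata with trap-state. Let $\Sigma$ be a finite alphabet. A $\mathsf{TMFA}$ with $k$ memories is $M=(Q,\Sigma,\delta,q_0,F)$ with finite state set $Q$ containing a special state $[\mathsf{trap}]$, initial state $q_0\in Q$, final states $F\subseteq Q$, and $\delta: Q\times(\Sigma\cup\{\varepsilon\}\cup\{1,\dots,k\})\to\mathcal{P}(Q\times\{\mathtt{o},\mathtt{c},\mathtt{r},\diamond\}^k)$, where $\delta([\mathsf{trap}],b)=\{([\mathsf{trap}],\diamond,\dots,\diamond)\}$ for $b\in\Sigma$ and $\delta([\mathsf{trap}],b)=\emptyset$ for other $b$. A configuration is $(q,w,(u_1,r_1),\dots,(u_k,r_k))$ with state $q$, remaining input $w$, memory contents $u_i\in\Sigma^*$ and statuses $r_i\in\{\mathtt{O},\mathtt{C}\}$ (open/closed). The initial configuration on $w$ is $(q_0,w,(\varepsilon,\mathtt{C}),\dots,(\varepsilon,\mathtt{C}))$; a configuration is accepting if $w=\varepsilon$ and $q\in F$. $M$ can move from $(q,vw,(u_i,r_i)_i)$ to $(p,w,(u_i',r_i')_i)$ if there is $(p,s_1,\dots,s_k)\in\delta(q,b)$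 with either $b\in\Sigma\cup\{\varepsilon\}$, $v=b$, or $b\in\{1,\dots,k\}$, $s_b=\mathtt{c}$, $v=u_b$ (memory recall), and for every $i$: $s_i=\diamond$, $r_i=\mathtt{O}$ give $(u_iv,\mathtt{O})$; $s_i=\diamond$, $r_i=\mathtt{C}$ give $(u_i,\mathtt{C})$; $s_i=\mathtt{o}$ gives $(v,\mathtt{O})$; $s_i=\mathtt{c}$ gives $(u_i,\mathtt{C})$; $s_i=\mathtt{r}$ gives $(\varepsilon,\mathtt{C})$. Furthermore (memory recall failure), $M$ can move from $(q,vw,(u_i,r_i)_i)$ to $([\mathsf{trap}],w,(u_i,r_i)_i)$ if there is $(p,s_1,\dots,s_k)\in\delta(q,b)$ with $b\in\{1,\dots,k\}$, $s_b=\mathtt{c}$, $u_b=vv'$, $v'\ne\varepsilon$, and $w=\varepsilon$ or the first letters of $v'$ and $w$ differ. $\mathcal{L}(M)$ is the set of $w\in\Sigma^*$ for which an accepting configuration is reachable from the initial configuration on $w$. A $\mathsf{TMFA}$ is deterministic (a $\mathsf{DTMFA}$) if $|\delta(q,b)|\le1$ for all $q,b$, and whenever $\delta(q,x)\neq\emptyset$ for some $x\in\{1,\dots,k\}\cup\{\varepsilon\}$, then $\delta(q,y)=\emptyset$ for all $y\ne x$. $\mathsf{DTMFA^{rej}}$ denotes the $\mathsf{DTMFA}$ with $[\mathsf{trap}]\notin F$, and $\mathcal{L}(\mathsf{DTMFA^{rej}})$ is the class of languages they accept. *)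

theory Defs
  imports "HOL-Library.Sublist"
begin

section \<open>Memory automata with trap-state\<close>

text \<open>The memories \<open>1, \<dots>, k\<close> are numbered \<open>0, \<dots>, k - 1\<close> here, so that memory lists and
  instruction lists of length \<open>k\<close> are indexed directly by \<open>!\<close>.\<close>

datatype 'a label = Letter 'a | Eps | Recall nat

text \<open>In this order, the instructions written o, c, r and \<open>\<diamond>\<close>.\<close>

datatype instr = Do_Open | Do_Close | Do_Reset | Keep

datatype status = Opened | Closed

record ('q, 'a) tmfa =
  states :: "'q set"
  alphabet :: "'a set"
  memories :: nat
  delta :: "'q \<Rightarrow> 'a label \<Rightarrow> ('q \<times> instr list) set"
  init :: 'q
  trap :: 'q
  finals :: "'q set"

definition labels :: "('q, 'a) tmfa \<Rightarrow> 'a label set" where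
  "labels M = Letter ` alphabet M \<union> {Eps} \<union> Recall ` {..<memories M}"

text \<open>Values of \<^const>\<open>delta\<close> outside \<open>states M \<times> labels M\<close> are unconstrained; they are never used.\<close>

definition is_tmfa :: "('q, 'a) tmfa \<Rightarrow> bool" where
  "is_tmfa M \<longleftrightarrow>
     finite (states M) \<and> finite (alphabet M) \<and>
     init M \<in> states M \<and> trap M \<in> states M \<and> finals M \<subseteq> states M \<and>
     (\<forall>q\<in>states M. \<forall>b\<in>labels M. delta M q b \<subseteq> states M \<times> {s. length s = memories M}) \<and>
     (\<forall>b\<in>labels M. delta M (trap M) b =
        (if b \<in> Letter ` alphabet M then {(trap M, replicate (memories M) Keep)} else {}))"

type_synonym 'a memory = "'a list \<times> status"
type_synonym ('q, 'a) config = "'q \<times> 'a list \<times> 'a memory list"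

fun update :: "'a list \<Rightarrow> instr \<Rightarrow> 'a memory \<Rightarrow> 'a memory" where
  "update v Keep (u, Opened) = (u @ v, Opened)"
| "update v Keep (u, Closed) = (u, Closed)"
| "update v Do_Open (u, r) = (v, Opened)"
| "update v Do_Close (u, r) = (u, Closed)"
| "update v Do_Reset (u, r) = ([], Closed)"

fun consumed :: "'a label \<Rightarrow> 'a memory list \<Rightarrow> 'a list" where
  "consumed (Letter a) ms = [a]"
| "consumed Eps ms = []"
| "consumed (Recall i) ms = fst (ms ! i)"

inductive step :: "('q, 'a) tmfa \<Rightarrow> ('q, 'a) config \<Rightarrow> ('q, 'a) config \<Rightarrow> bool"
  for M :: "('q, 'a) tmfa" where
  move: "\<lbrakk>b \<in> labels M; (p, s) \<in> delta M q b; \<forall>i. b = Recall i \<longrightarrow> s ! i = Do_Close;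
          v = consumed b ms\<rbrakk>
    \<Longrightarrow> step M (q, v @ w, ms) (p, w, map2 (update v) s ms)"
| recall_failure: "\<lbrakk>Recall i \<in> labels M; (p, s) \<in> delta M q (Recall i); s ! i = Do_Close;
          fst (ms ! i) = v @ v'; v' \<noteq> []; w = [] \<or> hd v' \<noteq> hd w\<rbrakk>
    \<Longrightarrow> step M (q, v @ w, ms) (trap M, w, ms)"

definition initial_config :: "('q, 'a) tmfa \<Rightarrow> 'a list \<Rightarrow> ('q, 'a) config" where
  "initial_config M w = (init M, w, replicate (memories M) ([], Closed))"

definition accepting :: "('q, 'a) tmfa \<Rightarrow> ('q, 'a) config \<Rightarrow> bool" where
  "accepting M c \<longleftrightarrow> (case c of (q, w, ms) \<Rightarrow> w = [] \<and> q \<in> finals M)"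

definition lang :: "('q, 'a) tmfa \<Rightarrow> 'a list set" where
  "lang M = {w \<in> lists (alphabet M). \<exists>c. (step M)\<^sup>*\<^sup>* (initial_config M w) c \<and> accepting M c}"

text \<open>For a TMFA the sets \<open>delta M q b\<close> below are finite, so that \<^const>\<open>card\<close> is meaningful.\<close>

definition is_dtmfa :: "('q, 'a) tmfa \<Rightarrow> bool" where
  "is_dtmfa M \<longleftrightarrow> is_tmfa M \<and>
     (\<forall>q\<in>states M. \<forall>b\<in>labels M. card (delta M q b) \<le> 1) \<and>
     (\<forall>q\<in>states M. \<forall>x \<in> Recall ` {..<memories M} \<union> {Eps}.
        delta M q x \<noteq> {} \<longrightarrow> (\<forall>y\<in>labels M. y \<noteq> x \<longrightarrow> delta M q y = {}))"

definition is_dtmfa_rej :: "('q, 'a) tmfa \<Rightarrow> bool" where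
  "is_dtmfa_rej M \<longleftrightarrow> is_dtmfa M \<and> trap M \<notin> finals M"

text \<open>The class of languages over \<open>A\<close> accepted by automata whose states are drawn from the type
  \<open>'q\<close>; HOL cannot quantify over the state type inside the definition, so it is a parameter.\<close>

definition DTMFA_rej_langs :: "'q itself \<Rightarrow> 'a set \<Rightarrow> 'a list set set" where
  "DTMFA_rej_langs _ A = {lang M | M :: ('q, 'a) tmfa. is_dtmfa_rej M \<and> alphabet M = A}"

section \<open>Regular languages\<close>

text \<open>Acceptance by a complete deterministic finite automaton over \<open>A\<close>. Every finite state set
  can be renamed into the natural numbers, so this choice of state type loses nothing.\<close>

definition regular_language :: "'a set \<Rightarrow> 'a list set \<Rightarrow> bool" where
  "regular_language A L \<longleftrightarrow>
     (\<exists>(Q :: nat set) \<delta> q\<^sub>0 F. finite Q \<and> q\<^sub>0 \<in> Q \<and> F \<subseteq> Q \<and>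
        (\<forall>q\<in>Q. \<forall>a\<in>A. \<delta> q a \<in> Q) \<and>
        L = {w \<in> lists A. foldl \<delta> q\<^sub>0 w \<in> F})"

end

theory Submission
  imports Defs
begin

text \<open>Since the trap state rejects, accepting runs contain only successful moves. If accepting runs
  recall arbitrarily long words, take such a run which recalls \<open>v\<close> after having read \<open>p\<close>: by
  determinism, every input \<open>p @ u\<close> with \<open>u \<noteq> []\<close> leads to the same recall, so it is rejected unless
  \<open>v\<close> is a prefix of \<open>u\<close>. If, on the contrary, all words recalled in accepting runs are shorter than
  \<open>m\<close>, then only the first \<open>m\<close> letters of each memory matter, which leaves finitely many
  configurations.\<close>

section \<open>Regularity from finitely many languages\<close>

text \<open>An injection of the finite set \<open>Q\<close> into the naturals renames the states, so
  automata over any state type become available, such as the sets of languages used below.\<close>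

lemma regular_languageI:
  fixes Q :: "'s set"
  assumes "finite Q" "q\<^sub>0 \<in> Q" and step: "\<And>q a. q \<in> Q \<Longrightarrow> a \<in> A \<Longrightarrow> \<delta> q a \<in> Q"
    and L: "L = {w \<in> lists A. foldl \<delta> q\<^sub>0 w \<in> F}"
  shows "regular_language A L"
proof -
  obtain h :: "'s \<Rightarrow> nat" where h: "inj_on h Q"
    using finite_imp_inj_to_nat_seg[OF \<open>finite Q\<close>] by blast
  define g where "g = inv_into Q h"
  define d where "d = (\<lambda>n a. h (\<delta> (g n) a))"
  have g[simp]: "g (h q) = q" if "q \<in> Q" for q
    using h that by (simp add: g_def)
  have fold: "foldl d (h q) w = h (foldl \<delta> q w) \<and> foldl \<delta> q w \<in> Q"
    if "q \<in> Q" "w \<in> lists A" for q w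
    using that by (induction w arbitrary: q) (auto simp: d_def step)
  \<comment> \<open>\<open>h\<close> is injective only on \<open>Q\<close>, hence the image of
    \<open>F \<inter> Q\<close> rather than of \<open>F\<close>.\<close>
  have "L = {w \<in> lists A. foldl d (h q\<^sub>0) w \<in> h ` (F \<inter> Q)}"
    using fold[OF \<open>q\<^sub>0 \<in> Q\<close>] inj_onD[OF h] unfolding L by fastforce
  moreover have "\<forall>n\<in>h ` Q. \<forall>a\<in>A. d n a \<in> h ` Q"
    by (auto simp: d_def step)
  ultimately show ?thesis
    unfolding regular_language_def using \<open>finite Q\<close> \<open>q\<^sub>0 \<in> Q\<close>
    by (intro exI[of _ "h ` Q"] exI[of _ d] exI[of _ "h q\<^sub>0"] exI[of _ "h ` (F \<inter> Q)"]) auto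
qed

text \<open>The members of \<open>B\<close> act as the states of a nondeterministic automaton, which is determinised
  by the subset construction.\<close>

lemma regular_language_finite_derivatives:
  assumes "finite B" "L \<in> B" "L \<subseteq> lists A"
    and deriv: "\<And>X a w. X \<in> B \<Longrightarrow> a \<in> A \<Longrightarrow> a # w \<in> X \<Longrightarrow> \<exists>Y\<in>B. w \<in> Y \<and> (\<forall>y\<in>Y. a # y \<in> X)"
  shows "regular_language A L"
proof -
  \<comment> \<open>\<open>Y\<close> is an \<open>a\<close>-successor of \<open>X\<close> as soon as
    prepending \<open>a\<close> maps \<open>Y\<close> into \<open>X\<close>; \<open>Y\<close> need
    not be the whole left quotient.\<close>
  define d where "d = (\<lambda>S a. {Y \<in> B. \<exists>X\<in>S. \<forall>y\<in>Y. a # y \<in> X})"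
  have fold: "[] \<in> \<Union> (foldl d S w) \<longleftrightarrow> w \<in> \<Union> S" if "S \<subseteq> B" "w \<in> lists A" for S w
    using that
  proof (induction w arbitrary: S)
    case (Cons a w)
    have "d S a \<subseteq> B" by (auto simp: d_def)
    \<comment> \<open>The union of all successors is nevertheless the exact left quotient by
      \<open>a\<close>: one inclusion is the definition of \<open>d\<close>, the other is
      \<open>deriv\<close>.\<close>
    moreover have "w \<in> \<Union> (d S a) \<longleftrightarrow> a # w \<in> \<Union> S"
    proof
      assume "a # w \<in> \<Union> S"
      then obtain X where "X \<in> S" "a # w \<in> X" by blast
      then show "w \<in> \<Union> (d S a)"
        using deriv[of X a w] Cons.prems unfolding d_def by auto
    qed (auto simp: d_def)
    ultimately show ?case using Cons by simp
  qed simp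
  show ?thesis
  proof (rule regular_languageI)
    show "finite (Pow B)" "{L} \<in> Pow B" using assms by auto
    show "d S a \<in> Pow B" for S a by (auto simp: d_def)
    show "L = {w \<in> lists A. foldl d {L} w \<in> {S. [] \<in> \<Union> S}}"
      using fold[of "{L}"] assms(2,3) by auto
  qed
qed

section \<open>Runs without recall failures\<close>

text \<open>The input is absent: a move is fixed by state, memories and label, and
  \<open>run\<close> collects the words that the moves consume.\<close>

definition moves ::
  "('q, 'a) tmfa \<Rightarrow> 'q \<Rightarrow> 'a memory list \<Rightarrow> 'a label \<Rightarrow> 'q \<Rightarrow> 'a memory list \<Rightarrow> bool" where
  "moves M q ms b q' ms' \<longleftrightarrow> b \<in> labels M \<and>
     (\<exists>s. (q', s) \<in> delta M q b \<and> (\<forall>i. b = Recall i \<longrightarrow> s ! i = Do_Close) \<and>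
        ms' = map2 (update (consumed b ms)) s ms)"

text \<open>\<open>N\<close> holds the admissible lengths of words consumed in one move:
  \<open>UNIV\<close> gives all runs, \<open>{..<m}\<close> those with short recalls only.\<close>

inductive run :: "('q, 'a) tmfa \<Rightarrow> nat set \<Rightarrow> 'q \<Rightarrow> 'a memory list \<Rightarrow> 'a list \<Rightarrow>
    'q \<Rightarrow> 'a memory list \<Rightarrow> bool"
  for M N where
  run_Nil: "run M N q ms [] q ms"
| run_move: "\<lbrakk>moves M q ms b q1 ms1; length (consumed b ms) \<in> N; run M N q1 ms1 w q2 ms2\<rbrakk>
    \<Longrightarrow> run M N q ms (consumed b ms @ w) q2 ms2"

definition accepted :: "('q, 'a) tmfa \<Rightarrow> nat set \<Rightarrow> 'q \<Rightarrow> 'a memory list \<Rightarrow> 'a list set" where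
  "accepted M N q ms = {w. \<exists>f\<in>finals M. \<exists>ms'. run M N q ms w f ms'}"

definition valid :: "('q, 'a) tmfa \<Rightarrow> 'q \<Rightarrow> 'a memory list \<Rightarrow> bool" where
  "valid M q ms \<longleftrightarrow> q \<in> states M \<and> length ms = memories M \<and> (\<forall>x\<in>set ms. fst x \<in> lists (alphabet M))"

lemma run_append:
  assumes "run M N q ms w q1 ms1" "run M N q1 ms1 w' q2 ms2"
  shows "run M N q ms (w @ w') q2 ms2"
  using assms by (induction rule: run.induct) (auto intro: run_move)

lemma run_mono:
  assumes "run M N q ms w q1 ms1" "N \<subseteq> N'"
  shows "run M N' q ms w q1 ms1"
  using assms by (induction rule: run.induct) (auto intro: run.intros)

lemma accepted_move:
  assumes "moves M q ms b q1 ms1" "length (consumed b ms) \<in> N" "w \<in> accepted M N q1 ms1"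
  shows "consumed b ms @ w \<in> accepted M N q ms"
  using assms by (auto simp: accepted_def intro: run_move)

lemma update_cases: "fst (update v i x) \<in> {[], v, fst x, fst x @ v}"
  by (cases "(v, i, x)" rule: update.cases) auto

lemma valid_initial:
  assumes "is_tmfa M"
  shows "valid M (init M) (replicate (memories M) ([], Closed))"
  using assms by (auto simp: valid_def is_tmfa_def)

lemma consumed_in_lists:
  assumes "valid M q ms" "b \<in> labels M"
  shows "consumed b ms \<in> lists (alphabet M)"
proof (cases b)
  case (Recall i)
  then have "ms ! i \<in> set ms" using assms by (auto simp: valid_def labels_def)
  then show ?thesis using assms(1) Recall by (auto simp: valid_def)
qed (use assms(2) in \<open>auto simp: labels_def\<close>)

lemma valid_moves:
  assumes "is_tmfa M" "valid M q ms" "moves M q ms b q' ms'"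
  shows "valid M q' ms'"
proof -
  obtain s where s: "b \<in> labels M" "(q', s) \<in> delta M q b"
    and ms': "ms' = map2 (update (consumed b ms)) s ms"
    using assms(3) by (auto simp: moves_def)
  have q': "q' \<in> states M" "length s = memories M"
    using assms(1,2) s unfolding is_tmfa_def valid_def by blast+
  have "fst (update (consumed b ms) i x) \<in> lists (alphabet M)" if "x \<in> set ms" for i x
  proof -
    have "fst x \<in> lists (alphabet M)" using that assms(2) by (auto simp: valid_def)
    then show ?thesis
      using update_cases[of "consumed b ms" i x] consumed_in_lists[OF assms(2) s(1)] by auto
  qed
  then have "\<forall>x\<in>set ms'. fst x \<in> lists (alphabet M)"
    unfolding ms' by (auto dest!: set_zip_rightD simp del: in_lists_conv_set)
  then show ?thesis using q' assms(2) ms' by (simp add: valid_def)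
qed

lemma valid_run:
  assumes "run M N q ms w q' ms'" "is_tmfa M" "valid M q ms"
  shows "valid M q' ms'"
  using assms by (induction rule: run.induct) (auto intro: valid_moves)

text \<open>An open memory is extended by the next word that is read, so it must be a suffix of the
  word read so far.\<close>

fun factor_memory :: "'a list \<Rightarrow> 'a memory \<Rightarrow> bool" where
  "factor_memory y (u, Opened) \<longleftrightarrow> suffix u y"
| "factor_memory y (u, Closed) \<longleftrightarrow> sublist u y"

lemma factor_memory_imp_sublist: "factor_memory y x \<Longrightarrow> sublist (fst x) y"
  by (cases "(y, x)" rule: factor_memory.cases) auto

lemma factor_memory_update:
  assumes "factor_memory y x"
  shows "factor_memory (y @ v) (update v i x)"
  using assms factor_memory_imp_sublist[OF assms]
  by (cases "(v, i, x)" rule: update.cases)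
     (auto simp: suffix_def sublist_def, (metis append.assoc)+)

lemma factor_memory_run:
  assumes "run M N q ms w q' ms'" "\<forall>x\<in>set ms. factor_memory y x"
  shows "\<forall>x\<in>set ms'. factor_memory (y @ w) x"
  using assms
proof (induction arbitrary: y rule: run.induct)
  case (run_move q ms b q1 ms1 w q2 ms2)
  have "\<forall>x\<in>set ms1. factor_memory (y @ consumed b ms) x"
    using run_move.hyps(1) run_move.prems
    by (auto simp: moves_def dest!: set_zip_rightD intro!: factor_memory_update)
  from run_move.IH[OF this] show ?case by simp
qed simp

section \<open>Runs and acceptance\<close>

text \<open>The trap state only leads to itself, so a computation ending elsewhere contains no
  recall failure and consists of moves alone.\<close>

lemma step_run:
  assumes "(step M)\<^sup>*\<^sup>* (q, w, ms) (q', w', ms')" "is_tmfa M" "q' \<noteq> trap M"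
  shows "\<exists>y. w = y @ w' \<and> run M UNIV q ms y q' ms'"
proof -
  have trap_step: "fst c' = trap M" if "step M c c'" "fst c = trap M" for c c'
    using that
  proof cases
    case (move b p s q v ms w)
    then have "delta M (trap M) b \<subseteq> {(trap M, replicate (memories M) Keep)}"
      using assms(2) that(2) by (auto simp: is_tmfa_def split: if_splits)
    then show ?thesis using move that(2) by auto
  qed simp
  have trap_steps: "fst c' = trap M" if "(step M)\<^sup>*\<^sup>* c c'" "fst c = trap M" for c c'
    using that by (induction rule: rtranclp_induct) (auto dest: trap_step)
  show ?thesis
    using assms(1)
  proof (induction "(q, w, ms)" arbitrary: q w ms rule: converse_rtranclp_induct)
    case base
    then show ?case by (auto intro: run_Nil)
  next
    case (step c)
    from step.hyps(1) show ?case
    proof cases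
      case (move b p s v w1)
      with step.hyps(3)[of p w1 "map2 (update v) s ms"] obtain y
        where "w1 = y @ w'" "run M UNIV p (map2 (update v) s ms) y q' ms'" by auto
      with move show ?thesis
        by (intro exI[of _ "v @ y"]) (auto simp: moves_def intro!: run_move[of _ _ _ b p])
    next
      case recall_failure
      then show ?thesis using trap_steps[OF step.hyps(2)] assms(3) by simp
    qed
  qed
qed

lemma run_steps:
  assumes "run M N q ms y q' ms'"
  shows "(step M)\<^sup>*\<^sup>* (q, y @ w, ms) (q', w, ms')"
  using assms
proof (induction rule: run.induct)
  case (run_move q ms b q1 ms1 y q2 ms2)
  have "step M (q, consumed b ms @ y @ w, ms) (q1, y @ w, ms1)"
    using run_move.hyps(1) by (auto simp: moves_def intro: step.move)
  then show ?case using run_move.IH by (simp add: converse_rtranclp_into_rtranclp)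
qed simp

lemma lang_eq_accepted:
  assumes "is_tmfa M" "trap M \<notin> finals M"
  shows "lang M = lists (alphabet M) \<inter>
    accepted M UNIV (init M) (replicate (memories M) ([], Closed))"
proof -
  let ?c0 = "replicate (memories M) ([], Closed)"
  have "(\<exists>c. (step M)\<^sup>*\<^sup>* (initial_config M w) c \<and> accepting M c) \<longleftrightarrow>
    w \<in> accepted M UNIV (init M) ?c0" for w
  proof
    assume "\<exists>c. (step M)\<^sup>*\<^sup>* (initial_config M w) c \<and> accepting M c"
    then obtain f ms where f: "f \<in> finals M" "(step M)\<^sup>*\<^sup>* (init M, w, ?c0) (f, [], ms)"
      by (auto simp: initial_config_def accepting_def)
    with assms(2) have "f \<noteq> trap M" by auto
    from step_run[OF f(2) assms(1) this] f(1) show "w \<in> accepted M UNIV (init M) ?c0"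
      by (auto simp: accepted_def)
  next
    assume "w \<in> accepted M UNIV (init M) ?c0"
    then show "\<exists>c. (step M)\<^sup>*\<^sup>* (initial_config M w) c \<and> accepting M c"
      using run_steps[of M UNIV "init M" ?c0 w _ _ "[]"]
      by (fastforce simp: accepted_def initial_config_def accepting_def)
  qed
  then show ?thesis by (auto simp: lang_def)
qed

section \<open>Bounded recalls\<close>

text \<open>Keeping \<open>m\<close> letters distinguishes every content shorter than
  \<open>m\<close>, which is kept whole, from the contents of length at least
  \<open>m\<close>.\<close>

definition trunc :: "nat \<Rightarrow> 'a memory \<Rightarrow> 'a memory" where
  "trunc m x = (take m (fst x), snd x)"

text \<open>Appending is the only instruction that uses the old content to build a new one, and the
  first \<open>m\<close> letters of \<open>u @ v\<close> depend only on \<open>v\<close> and the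
  first \<open>m\<close> letters of \<open>u\<close>.\<close>

lemma trunc_update:
  assumes "trunc m x = trunc m y"
  shows "trunc m (update v i x) = trunc m (update v i y)"
proof -
  obtain u r where x: "x = (u, r)" by fastforce
  obtain u' where y: "y = (u', r)" and eq: "take m u = take m u'"
    using assms x by (cases y) (simp add: trunc_def)
  have "take m (z @ v) = take m (take m z @ v)" for z
    by (simp add: min_def)
  from this[of u] this[of u'] have "take m (u @ v) = take m (u' @ v)"
    using eq by metis
  then show ?thesis
    using eq unfolding x y trunc_def by (cases i; cases r) (simp_all only: update.simps fst_conv snd_conv)
qed

lemma moves_trunc:
  assumes mv: "moves M q ms b q1 ms1" and m: "length (consumed b ms) < m"
    and eq: "map (trunc m) ms = map (trunc m) ns" and len: "length ms = memories M"
  shows "\<exists>ns1. moves M q ns b q1 ns1 \<and> map (trunc m) ms1 = map (trunc m) ns1 \<and>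
    consumed b ns = consumed b ms"
proof -
  have lenn: "length ns = length ms" using eq map_eq_imp_length_eq by metis
  have nth: "trunc m (ms ! j) = trunc m (ns ! j)" if "j < length ms" for j
    using eq that lenn by (metis nth_map)
  have cons: "consumed b ns = consumed b ms"
  proof (cases b)
    case (Recall j)
    then have "j < length ms" using mv len by (auto simp: moves_def labels_def)
    from nth[OF this] have "take m (fst (ms ! j)) = take m (fst (ns ! j))"
      by (simp add: trunc_def)
    \<comment> \<open>A truncation shorter than \<open>m\<close> has cut nothing off, so both
      memories hold the same word.\<close>
    moreover have "length (take m (fst (ns ! j))) < m"
      using m Recall unfolding calculation[symmetric] by simp
    ultimately show ?thesis using m Recall by simp
  qed auto
  obtain s where s: "b \<in> labels M" "(q1, s) \<in> delta M q b" "\<forall>i. b = Recall i \<longrightarrow> s ! i = Do_Close"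
    "ms1 = map2 (update (consumed b ms)) s ms"
    using mv by (auto simp: moves_def)
  let ?ns1 = "map2 (update (consumed b ms)) s ns"
  have "map (trunc m) ms1 = map (trunc m) ?ns1"
    unfolding s(4) by (rule nth_equalityI) (auto simp: lenn intro!: trunc_update nth)
  then show ?thesis using s cons by (intro exI[of _ ?ns1]) (auto simp: moves_def)
qed

text \<open>Memory lists with equal truncations simulate each other move by move, because a run over
  \<open>{..<m}\<close> recalls only words that the truncation keeps whole.\<close>

lemma run_trunc:
  assumes "run M {..<m} q ms w q' ms'" "is_tmfa M" "valid M q ms"
    and "map (trunc m) ms = map (trunc m) ns"
  shows "\<exists>ns'. run M {..<m} q ns w q' ns'"
  using assms
proof (induction arbitrary: ns rule: run.induct)
  case (run_move q ms b q1 ms1 w q2 ms2)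
  then obtain ns1 where ns1: "moves M q ns b q1 ns1" "map (trunc m) ms1 = map (trunc m) ns1"
    "consumed b ns = consumed b ms"
    using moves_trunc[of M q ms b q1 ms1 m ns] by (auto simp: valid_def)
  obtain ns' where "run M {..<m} q1 ns1 w q2 ns'"
    using run_move.IH[OF _ _ ns1(2)] run_move.prems run_move.hyps(1) valid_moves by metis
  then show ?case using run.run_move[of M q ns b q1 ns1 "{..<m}" w q2 ns'] ns1 run_move.hyps(2)
    by auto
qed (auto intro: run_Nil)

lemma accepted_trunc:
  assumes "is_tmfa M" "valid M q ms"
  shows "accepted M {..<m} q (map (trunc m) ms) = accepted M {..<m} q ms"
proof -
  have trunc_idem: "map (trunc m) (map (trunc m) ms) = map (trunc m) ms"
    by (simp add: trunc_def)
  have "valid M q (map (trunc m) ms)"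
    using assms(2) by (fastforce simp: valid_def trunc_def dest: in_set_takeD)
  then show ?thesis
    using run_trunc[OF _ assms(1)] assms(2) trunc_idem
    unfolding accepted_def by (intro Collect_cong bex_cong refl) metis
qed

text \<open>Each of these languages is already given by a state and truncated memories, of which
  there are finitely many.\<close>

lemma finite_accepted:
  assumes "is_tmfa M"
  shows "finite {accepted M {..<m} q ms | q ms. valid M q ms}"
proof -
  let ?W = "{u. set u \<subseteq> alphabet M \<and> length u \<le> m}"
  let ?V = "{ms. set ms \<subseteq> ?W \<times> {Opened, Closed} \<and> length ms = memories M}"
  have "{accepted M {..<m} q ms | q ms. valid M q ms}
    \<subseteq> (\<lambda>(q, ms). accepted M {..<m} q ms) ` (states M \<times> ?V)"
  proof clarify
    fix q ms assume v: "valid M q ms"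
    have "map (trunc m) ms \<in> ?V"
    proof -
      have "trunc m x \<in> ?W \<times> {Opened, Closed}" if "x \<in> set ms" for x
        using that v by (cases "snd x")
          (fastforce simp: valid_def trunc_def dest: in_set_takeD)+
      then have "trunc m ` set ms \<subseteq> ?W \<times> {Opened, Closed}" by blast
      then show ?thesis using v by (simp add: valid_def)
    qed
    then have "(q, map (trunc m) ms) \<in> states M \<times> ?V" using v by (auto simp: valid_def)
    then show "accepted M {..<m} q ms \<in> (\<lambda>(q, ms). accepted M {..<m} q ms) ` (states M \<times> ?V)"
      using accepted_trunc[OF assms v] by (metis (mono_tags, lifting) case_prod_conv image_eqI)
  qed
  moreover have "finite ?W" using assms by (auto simp: is_tmfa_def finite_lists_length_le)
  then have "finite (states M \<times> ?V)"
    using assms by (auto simp: is_tmfa_def intro!: finite_lists_length_eq)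
  ultimately show ?thesis by (rule finite_subset[OF _ finite_imageI])
qed

text \<open>After some moves consuming nothing, one move consumes \<open>a # u\<close>; then
  \<open>u\<close> is still to be read before the next configuration takes over. The equation for
  \<open>w'\<close> keeps the input a variable for the induction.\<close>

lemma accepted_derivative:
  assumes "run M {..<m} q ms w' q' ms'" "q' \<in> finals M" "w' = a # w" "is_tmfa M" "valid M q ms"
  shows "\<exists>u q1 ms1. u \<in> lists (alphabet M) \<and> length u \<le> m \<and> valid M q1 ms1 \<and>
    w \<in> (@) u ` accepted M {..<m} q1 ms1 \<and>
    (\<forall>y \<in> (@) u ` accepted M {..<m} q1 ms1. a # y \<in> accepted M {..<m} q ms)"
  using assms
proof (induction rule: run.induct)
  case (run_move q ms b q1 ms1 w1 q2 ms2)
  note acc = accepted_move[OF run_move.hyps(1,2)]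
  have v1: "valid M q1 ms1" using run_move.prems run_move.hyps(1) valid_moves by metis
  show ?case
  proof (cases "consumed b ms")
    \<comment> \<open>The letter \<open>a\<close> is read later, so the witnesses of the induction
      hypothesis carry over along this move.\<close>
    case Nil
    with run_move.prems have "w1 = a # w" by simp
    from run_move.IH[OF run_move.prems(1) this run_move.prems(3) v1] obtain u p ns where
      "u \<in> lists (alphabet M)" "length u \<le> m" "valid M p ns"
      "w \<in> (@) u ` accepted M {..<m} p ns"
      "\<forall>y \<in> (@) u ` accepted M {..<m} p ns. a # y \<in> accepted M {..<m} q1 ms1"
      by blast
    moreover have "accepted M {..<m} q1 ms1 \<subseteq> accepted M {..<m} q ms"
      using acc Nil by auto
    ultimately show ?thesis by blast
  next
    case (Cons c u)
    have "consumed b ms \<in> lists (alphabet M)"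
      by (rule consumed_in_lists) (use run_move.hyps(1) run_move.prems(4) in \<open>auto simp: moves_def\<close>)
    moreover have "w1 \<in> accepted M {..<m} q1 ms1"
      using run_move.hyps(3) run_move.prems by (auto simp: accepted_def)
    ultimately show ?thesis
      using Cons run_move.hyps(2) run_move.prems v1 acc
      by (intro exI[of _ u] exI[of _ q1] exI[of _ ms1]) auto
  qed
qed simp

lemma regular_accepted_bounded:
  assumes "is_tmfa M" "valid M q ms"
  shows "regular_language (alphabet M) (lists (alphabet M) \<inter> accepted M {..<m} q ms)"
proof -
  let ?A = "alphabet M"
  let ?U = "{u. set u \<subseteq> ?A \<and> length u \<le> m}"
  let ?C = "{accepted M {..<m} q ms | q ms. valid M q ms}"
  \<comment> \<open>A state of the finite automaton: \<open>u\<close> is the unread rest of the last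
    consumed word, \<open>X\<close> the language accepted after it.\<close>
  define lan where "lan = (\<lambda>(u, X). lists ?A \<inter> (@) (u :: 'b list) ` X)"
  let ?B = "lan ` (?U \<times> ?C)"
  have "finite ?U" using assms by (auto simp: is_tmfa_def finite_lists_length_le)
  then have fin: "finite ?B" using finite_accepted[OF assms(1)] by auto
  have memB: "lists ?A \<inter> (@) u ` accepted M {..<m} q ms \<in> ?B"
    if "u \<in> lists ?A" "length u \<le> m" "valid M q ms" for u q ms
    using that unfolding lan_def by (auto simp: lists_eq_set intro!: image_eqI[of _ _ "(u, _)"])
  show ?thesis
  proof (rule regular_language_finite_derivatives[OF fin])
    show "lists ?A \<inter> accepted M {..<m} q ms \<in> ?B" using memB[of "[]"] assms(2) by simp
  next
    fix X a w assume "X \<in> ?B" and a: "a \<in> ?A" and aw: "a # w \<in> X"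
    then obtain u q ms where u: "u \<in> lists ?A" "length u \<le> m" and v: "valid M q ms"
      and X: "X = lists ?A \<inter> (@) u ` accepted M {..<m} q ms"
      unfolding lan_def by (auto simp: lists_eq_set)
    show "\<exists>Y\<in>?B. w \<in> Y \<and> (\<forall>y\<in>Y. a # y \<in> X)"
    proof (cases u)
      \<comment> \<open>No letter is pending, so the memory automaton has to move on.\<close>
      case Nil
      then have "a # w \<in> accepted M {..<m} q ms" using aw X by auto
      then obtain f ms' where "run M {..<m} q ms (a # w) f ms'" "f \<in> finals M"
        by (auto simp: accepted_def)
      from accepted_derivative[OF this refl assms(1) v] obtain u1 q1 ms1 where
        "u1 \<in> lists ?A" "length u1 \<le> m" "valid M q1 ms1"
        "w \<in> (@) u1 ` accepted M {..<m} q1 ms1"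
        "\<forall>y \<in> (@) u1 ` accepted M {..<m} q1 ms1. a # y \<in> accepted M {..<m} q ms"
        by blast
      then show ?thesis
        using memB[of u1 q1 ms1] aw X a Nil
        by (intro bexI[of _ "lists ?A \<inter> (@) u1 ` accepted M {..<m} q1 ms1"]) auto
    next
      \<comment> \<open>Reading \<open>a\<close> removes the first pending letter; the configuration
        stays the same.\<close>
      case (Cons c u1)
      then show ?thesis
        using memB[of u1 q ms] u v aw X a
        by (intro bexI[of _ "lists ?A \<inter> (@) u1 ` accepted M {..<m} q ms"]) auto
    qed
  qed simp
qed

text \<open>The assumption ranges over all ways to split the run around a single move; it passes to
  the tail of the run because prepending the first move turns splittings of the tail into splittings
  of the whole.\<close>

lemma run_bounded:
  assumes "run M UNIV q ms w f ms'" "\<And>y q1 ms1 b q2 ms2 z.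
      \<lbrakk>run M UNIV q ms y q1 ms1; moves M q1 ms1 b q2 ms2; run M UNIV q2 ms2 z f ms';
        w = y @ consumed b ms1 @ z\<rbrakk> \<Longrightarrow> length (consumed b ms1) \<in> N"
  shows "run M N q ms w f ms'"
  using assms
proof (induction rule: run.induct)
  case (run_move q ms b q1 ms1 w f ms')
  have "length (consumed b ms) \<in> N"
    using run_move.prems[OF run_Nil run_move.hyps(1,3)] by simp
  moreover have "run M N q1 ms1 w f ms'"
  proof (rule run_move.IH)
    fix y p ns b' p' ns' z
    assume "run M UNIV q1 ms1 y p ns" "moves M p ns b' p' ns'" "run M UNIV p' ns' z f ms'"
      "w = y @ consumed b' ns @ z"
    then show "length (consumed b' ns) \<in> N"
      using run_move.prems[of "consumed b ms @ y" p ns b' p' ns' z]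
        run.run_move[OF run_move.hyps(1,2)] by simp
  qed
  ultimately show ?case using run_move.hyps(1) by (auto intro: run.run_move)
qed (rule run_Nil)

section \<open>Determinism\<close>

lemma is_dtmfa_imp_is_tmfa: "is_dtmfa M \<Longrightarrow> is_tmfa M"
  unfolding is_dtmfa_def by (rule conjunct1)

lemma nonletter_moves_exclusive:
  assumes "is_dtmfa M" "q \<in> states M" "moves M q ms x q1 ms1" "moves M q ns y q2 ns2"
    and "\<forall>a. x \<noteq> Letter a"
  shows "y = x"
proof -
  have "x \<in> Recall ` {..<memories M} \<union> {Eps}" "y \<in> labels M"
    "delta M q x \<noteq> {}" "delta M q y \<noteq> {}"
    using assms(3-5) by (auto simp: moves_def labels_def)
  moreover have "\<forall>x \<in> Recall ` {..<memories M} \<union> {Eps}.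
      delta M q x \<noteq> {} \<longrightarrow> (\<forall>y\<in>labels M. y \<noteq> x \<longrightarrow> delta M q y = {})"
    using assms(1,2) unfolding is_dtmfa_def by (elim conjE) (rule bspec)
  ultimately show ?thesis by metis
qed

text \<open>Two letter labels agree since both begin the same word, and any other label excludes all
  competitors. With the label fixed, at most one transition is left.\<close>

lemma moves_deterministic:
  assumes D: "is_dtmfa M" and q: "q \<in> states M"
    and mv: "moves M q ms b q1 ms1" "moves M q ms b' q2 ms2"
    and cons: "consumed b ms @ w = consumed b' ms @ w'"
  shows "b' = b \<and> q2 = q1 \<and> ms2 = ms1"
proof -
  have "b' = b"
  proof (cases "(\<exists>a. b = Letter a) \<and> (\<exists>a. b' = Letter a)")
    case True
    then show ?thesis using cons by auto
  next
    case False
    then show ?thesis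
      using nonletter_moves_exclusive[OF D q mv] nonletter_moves_exclusive[OF D q mv(2,1)] by metis
  qed
  moreover have b: "b \<in> labels M" using mv by (simp add: moves_def)
  \<comment> \<open>Infinite sets have \<open>card\<close> equal to 0, so the bound on
    \<open>card\<close> says something only once finiteness is known.\<close>
  moreover have "finite (delta M q b)"
  proof (rule finite_subset)
    let ?I = "{Do_Open, Do_Close, Do_Reset, Keep}"
    have I: "set s \<subseteq> ?I" for s using instr.exhaust by blast
    have "delta M q b \<subseteq> states M \<times> {s. length s = memories M}"
      using D q b by (simp add: is_dtmfa_def is_tmfa_def)
    then show "delta M q b \<subseteq> states M \<times> {s. set s \<subseteq> ?I \<and> length s = memories M}"
      using I by simp
    show "finite (states M \<times> {s. set s \<subseteq> ?I \<and> length s = memories M})"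
      using D by (simp add: is_dtmfa_def is_tmfa_def finite_lists_length_eq)
  qed
  moreover have "card (delta M q b) \<le> Suc 0"
    using D q b by (simp add: is_dtmfa_def)
  ultimately show ?thesis
    using mv by (auto simp: moves_def card_le_Suc0_iff_eq)
qed

lemma run_first_moveE:
  assumes "run M N q ms w q2 ms2" "w \<noteq> []"
  obtains b q1 ms1 w' where "w = consumed b ms @ w'" "moves M q ms b q1 ms1"
    "run M N q1 ms1 w' q2 ms2"
  using assms(1)
proof cases
  case run_Nil
  then show ?thesis using assms(2) by simp
next
  case (run_move b q1 ms1 w')
  show ?thesis by (rule that[OF run_move(1,2,4)])
qed

text \<open>As long as the first run has moves left, the second still has the nonempty
  \<open>x\<close> ahead, so it must move too, and in the same way. For empty \<open>x\<close> it
  could stop before moves that consume nothing.\<close>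

lemma run_deterministic:
  assumes "run M N q ms y q1 ms1" "is_dtmfa M" "valid M q ms"
    and "run M N q ms (y @ x) q2 ms2" "x \<noteq> []"
  shows "run M N q1 ms1 x q2 ms2"
  using assms
proof (induction rule: run.induct)
  case (run_move q ms b p ns y q1 ms1)
  note prems = run_move.prems
  from prems(3,4) obtain b' p' ns' w where w: "(consumed b ms @ y) @ x = consumed b' ms @ w"
    and mv: "moves M q ms b' p' ns'" and run: "run M N p' ns' w q2 ms2"
    by (auto elim: run_first_moveE)
  from w have w': "consumed b ms @ y @ x = consumed b' ms @ w" by simp
  have "q \<in> states M" using prems(2) by (simp add: valid_def)
  from moves_deterministic[OF prems(1) this run_move.hyps(1) mv w']
  have "b' = b" "p' = p" "ns' = ns" by auto
  with w' run have "run M N p ns (y @ x) q2 ms2" by simp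
  moreover have "valid M p ns"
    by (rule valid_moves[OF is_dtmfa_imp_is_tmfa[OF prems(1)] prems(2) run_move.hyps(1)])
  ultimately show ?case using run_move.IH[OF prems(1)] prems(4) by simp
qed simp

text \<open>Reading a nonempty word requires a first move, and an available recall excludes every
  other label.\<close>

lemma run_prefix_recall:
  assumes D: "is_dtmfa M" and q: "q \<in> states M"
    and mv: "moves M q ms (Recall i) q1 ms1"
    and run: "run M N q ms x q2 ms2" "x \<noteq> []"
  shows "prefix (consumed (Recall i) ms) x"
proof -
  from run obtain b p ns w where x: "x = consumed b ms @ w" and b: "moves M q ms b p ns"
    by (rule run_first_moveE)
  have "b = Recall i" using nonletter_moves_exclusive[OF D q mv b] by simp
  then show ?thesis using x by simp
qed

text \<open>The recalled word comes from a memory filled while reading \<open>p\<close>, which makes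
  it a factor of \<open>p\<close>. Any accepting run on \<open>p @ u\<close> passes through the same
  configuration and faces the same recall.\<close>

lemma long_recall_jump:
  fixes M :: "('q, 'a) tmfa"
  defines "c0 \<equiv> replicate (memories M) ([], Closed)"
  assumes D: "is_dtmfa_rej M"
    and pre: "run M UNIV (init M) c0 p q ms" and mv: "moves M q ms b q1 ms1"
    and post: "run M UNIV q1 ms1 z f ms'" and f: "f \<in> finals M"
    and w: "p @ consumed b ms @ z \<in> lists (alphabet M)"
    and long: "2 \<le> length (consumed b ms)"
  shows "p \<noteq> []" "sublist (consumed b ms) p" "p @ consumed b ms @ z \<in> lang M"
    "\<forall>u \<in> lists (alphabet M) - {[]}. p @ u \<in> lang M \<longrightarrow> prefix (consumed b ms) u"
proof -
  have tm: "is_tmfa M" "is_dtmfa M" "trap M \<notin> finals M"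
    using D is_dtmfa_imp_is_tmfa by (auto simp: is_dtmfa_rej_def)
  note lang = lang_eq_accepted[OF tm(1,3), folded c0_def]
  have v0: "valid M (init M) c0" using valid_initial[OF tm(1)] by (simp add: c0_def)
  have v: "valid M q ms" by (rule valid_run[OF pre tm(1) v0])
  \<comment> \<open>Letters and empty moves consume at most one letter.\<close>
  obtain i where b: "b = Recall i" using long by (cases b) auto
  then have "i < length ms" using mv v by (auto simp: moves_def labels_def valid_def)
  then have "ms ! i \<in> set ms" by simp
  \<comment> \<open>Before anything is read all memories are empty, so they satisfy the invariant
    for \<open>[]\<close>.\<close>
  then have "factor_memory ([] @ p) (ms ! i)"
    using factor_memory_run[OF pre, of "[]"] by (auto simp: c0_def)
  then show sub: "sublist (consumed b ms) p" using b factor_memory_imp_sublist by simp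
  then show "p \<noteq> []" using long by auto
  show "p @ consumed b ms @ z \<in> lang M"
    unfolding lang accepted_def
    using w f run_append[OF pre run_move[OF mv UNIV_I post]] by auto
  show "\<forall>u \<in> lists (alphabet M) - {[]}. p @ u \<in> lang M \<longrightarrow> prefix (consumed b ms) u"
  proof (intro ballI impI)
    fix u assume u: "u \<in> lists (alphabet M) - {[]}" "p @ u \<in> lang M"
    then obtain g ns where "run M UNIV (init M) c0 (p @ u) g ns"
      by (auto simp: lang accepted_def)
    then have "run M UNIV q ms u g ns" using run_deterministic[OF pre tm(2) v0] u by auto
    then show "prefix (consumed b ms) u"
      using run_prefix_recall[OF tm(2) _ mv[unfolded b]] v u b by (auto simp: valid_def)
  qed
qed

theorem lemma1:
  fixes \<Sigma> :: "'a set" and L :: "'a list set"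
  assumes "L \<in> DTMFA_rej_langs TYPE('q) \<Sigma>"
  shows "regular_language \<Sigma> L \<or>
    (\<forall>m :: nat. \<exists>n\<ge>m. \<exists>p \<in> lists \<Sigma> - {[]}. \<exists>v \<in> lists \<Sigma> - {[]}.
       length v = n \<and>
       sublist v p \<and>
       (\<exists>w\<in>L. prefix (p @ v) w) \<and>
       (\<forall>u \<in> lists \<Sigma> - {[]}. p @ u \<in> L \<longrightarrow> prefix v u))"
proof -
  obtain M :: "('q, 'a) tmfa" where D: "is_dtmfa_rej M" and L: "L = lang M" and S: "\<Sigma> = alphabet M"
    using assms by (auto simp: DTMFA_rej_langs_def)
  let ?c0 = "replicate (memories M) ([], Closed)"
  have tm: "is_tmfa M" "trap M \<notin> finals M"
    using D is_dtmfa_imp_is_tmfa by (auto simp: is_dtmfa_rej_def)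
  note lang = lang_eq_accepted[OF tm]
  show ?thesis
  \<comment> \<open>The split asks for a common bound on all words consumed in a single move of an
    accepting run, letters included.\<close>
  proof (cases "\<exists>m\<ge>2. \<forall>p q ms b q1 ms1 z f ms'.
      run M UNIV (init M) ?c0 p q ms \<longrightarrow> moves M q ms b q1 ms1 \<longrightarrow>
      run M UNIV q1 ms1 z f ms' \<longrightarrow> f \<in> finals M \<longrightarrow>
      p @ consumed b ms @ z \<in> lists \<Sigma> \<longrightarrow> length (consumed b ms) < m")
    case True
    then obtain m where m: "\<And>p q ms b q1 ms1 z f ms'. \<lbrakk>run M UNIV (init M) ?c0 p q ms;
      moves M q ms b q1 ms1; run M UNIV q1 ms1 z f ms'; f \<in> finals M;
      p @ consumed b ms @ z \<in> lists \<Sigma>\<rbrakk> \<Longrightarrow> length (consumed b ms) < m"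
      by blast
    have "lists \<Sigma> \<inter> accepted M UNIV (init M) ?c0 = lists \<Sigma> \<inter> accepted M {..<m} (init M) ?c0"
    proof (intro equalityI subsetI IntI)
      fix w assume w: "w \<in> lists \<Sigma> \<inter> accepted M UNIV (init M) ?c0"
      then obtain f ms' where f: "f \<in> finals M" and r: "run M UNIV (init M) ?c0 w f ms'"
        by (auto simp: accepted_def)
      have "run M {..<m} (init M) ?c0 w f ms'"
      proof (rule run_bounded[OF r])
        fix y q1 ms1 b q2 ms2 z
        assume "run M UNIV (init M) ?c0 y q1 ms1" "moves M q1 ms1 b q2 ms2"
          "run M UNIV q2 ms2 z f ms'" "w = y @ consumed b ms1 @ z"
        then show "length (consumed b ms1) \<in> {..<m}"
          using m[of y q1 ms1 b q2 ms2 z f ms'] f w by blast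
      qed
      with f show "w \<in> accepted M {..<m} (init M) ?c0" by (auto simp: accepted_def)
    qed (auto simp: accepted_def intro: run_mono)
    then have "L = lists (alphabet M) \<inter> accepted M {..<m} (init M) ?c0"
      unfolding L lang S by simp
    then show ?thesis
      using regular_accepted_bounded[OF tm(1) valid_initial[OF tm(1)], of m] by (simp add: S)
  next
    case False
    show ?thesis
    proof (intro disjI2 allI)
      fix m :: nat
      \<comment> \<open>Exceeding the bound \<open>max m 2\<close> gives a word of length at least
        \<open>m\<close> that is also too long to be a single letter, hence a recall.\<close>
      have "2 \<le> max m 2" by simp
      with False obtain p q ms b q1 ms1 z f ms' where
        r: "run M UNIV (init M) ?c0 p q ms" "moves M q ms b q1 ms1"
          "run M UNIV q1 ms1 z f ms'" "f \<in> finals M"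
        and w: "p @ consumed b ms @ z \<in> lists \<Sigma>" and long: "max m 2 \<le> length (consumed b ms)"
        by (meson not_less)
      have 2: "2 \<le> length (consumed b ms)" using long by simp
      note jump = long_recall_jump[OF D r w[unfolded S] 2, folded L S]
      let ?v = "consumed b ms"
      have "p \<in> lists \<Sigma> - {[]}" "?v \<in> lists \<Sigma> - {[]}" using w jump(1) 2 by auto
      moreover have "\<exists>w\<in>L. prefix (p @ ?v) w" using jump(3) by (intro bexI) auto
      ultimately show "\<exists>n\<ge>m. \<exists>p \<in> lists \<Sigma> - {[]}. \<exists>v \<in> lists \<Sigma> - {[]}.
         length v = n \<and> sublist v p \<and> (\<exists>w\<in>L. prefix (p @ v) w) \<and>
         (\<forall>u \<in> lists \<Sigma> - {[]}. p @ u \<in> L \<longrightarrow> prefix v u)"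
        using jump(2,4) long by (intro exI[of _ "length ?v"]) auto
    qed
  qed
qed

end
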